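(* Let $n\in\mathbb{N}$, $p\in[0,1]$, $q=1-p$, and let $\alpha=(\alpha_1,\dots,\alpha_n)\in[n]^n$ satisfy $\alpha_i\le i$ for all $i\in[n]$. Consider the probabilistic parking protocol with open boundary condition with preference list $\alpha$ and parameter $p$. Let $1<i\le n$. (1) If the conditioning event has positive probability, then $$\Pr\Big[X_\alpha^i=1\;\Big|\;\prod_{j=1}^{i-1}X_\alpha^j=1\Big]=\begin{cases}\dfrac{\alpha_i}{i} & \text{if } p=\tfrac12,\\[2mm] p^{\,i-\alpha_i}\,\dfrac{p^{\alpha_i}-q^{\alpha_i}}{p^i-q^i} & \text{otherwise.}\end{cases}$$ (2) If $p>0$, then $$\mathbb{E}\Big[\tau_\alpha^i\;\Big|\;\prod_{j=1}^{i}X_\alpha^j=1\Big]=\begin{cases}\dfrac13\,(i^2-\alpha_i^2) & \text{if } p=\tfrac12,\\[2mm] \dfrac{1}{p-q}\left(\dfrac{i\left(1+(q/p)^i\right)}{1-(q/p)^i}-\dfrac{\alpha_i\left(1+(q/p)^{\alpha_i}\right)}{1-(q/p)^{\alpha_i}}\right) & \text{otherwise.}\end{cases}$$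
   Context: $[n]=\{1,\dots,n\}$; the convention $0^0=1$ is used. Preference lists with $\alpha_i\le i$ for all $i$ are exactly the parking functions whose classical outcome is the identity permutation. Probabilistic parking protocol with open boundary: cars $1,2,\dots,n$ arrive one at a time in this order, each entering after its predecessor has finished its search. Car $i$ starts at spot $\alpha_i$ and performs a nearest-neighbour random walk (independent of the walks of the other cars), each step being $+1$ with probability $p$ and $-1$ with probability $q=1-p$, until it either first visits an unoccupied spot of $[n]$, where it parks immediately (in zero steps if $\alpha_i$ is unoccupied), or leaves $[n]$ (enters $0$ or $n+1$), in which case its search terminates and it does not park. $X_\alpha^i$ is the indicator that car $i$ parks. When cars $1,\dots,i-1$ all park they occupy precisely spots $1,\dots,i-1$, and car $i$ parks if and only if its walk hits $i$ before $0$. $Z_t^i$ is the position of car $i$ after $t$ steps ($Z_0^i=\alpha_i$), and $\tau_\alpha^i=\min\{t\ge0: Z_t^i=i\text{ or }Z_t^i=0\}$. *)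

theory Defs
  imports "HOL-Probability.Probability"
begin

text \<open>Step \<open>t\<close> of car \<open>j\<close> is \<open>\<xi> j t\<close>. Each car carries an infinite supply of steps; only those
  taken before its search ends matter for the protocol. The steps of all cars are jointly
  independent.\<close>

locale parking_steps = prob_space M for M :: "'w measure" +
  fixes n :: nat and p :: real and \<xi> :: "nat \<Rightarrow> nat \<Rightarrow> 'w \<Rightarrow> int"
  assumes indep_steps:
      "indep_vars (\<lambda>_. count_space UNIV) (\<lambda>(j, t). \<xi> j t) ({1..n} \<times> (UNIV :: nat set))"
    and prob_right: "\<And>j t. j \<in> {1..n} \<Longrightarrow> \<P>(\<omega> in M. \<xi> j t \<omega> = 1) = p"
    and prob_left: "\<And>j t. j \<in> {1..n} \<Longrightarrow> \<P>(\<omega> in M. \<xi> j t \<omega> = - 1) = 1 - p"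

definition walk :: "(nat \<Rightarrow> nat) \<Rightarrow> (nat \<Rightarrow> nat \<Rightarrow> 'w \<Rightarrow> int) \<Rightarrow> nat \<Rightarrow> nat \<Rightarrow> 'w \<Rightarrow> int" where
  "walk \<alpha> \<xi> i t \<omega> = int (\<alpha> i) + (\<Sum>s<t. \<xi> i s \<omega>)"

text \<open>The search along a trajectory \<open>z\<close> ends at the first visit to a position which is either
  outside \<open>[n]\<close> or an unoccupied spot. The car parks in the latter case only; a car whose search
  never ends does not park.\<close>

definition search_ends :: "nat \<Rightarrow> int set \<Rightarrow> int \<Rightarrow> bool" where
  "search_ends n Occ x \<longleftrightarrow> x \<notin> {1..int n} \<or> x \<notin> Occ"

definition parking_spot :: "nat \<Rightarrow> int set \<Rightarrow> (nat \<Rightarrow> int) \<Rightarrow> int option" where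
  "parking_spot n Occ z =
    (if \<exists>t. search_ends n Occ (z t)
     then (let x = z (LEAST t. search_ends n Occ (z t))
           in if x \<in> {1..int n} then Some x else None)
     else None)"

text \<open>\<open>occupied n \<alpha> \<xi> \<omega> i\<close> is the set of spots taken once cars \<open>1, \<dots>, i\<close> have finished.\<close>

primrec occupied ::
  "nat \<Rightarrow> (nat \<Rightarrow> nat) \<Rightarrow> (nat \<Rightarrow> nat \<Rightarrow> 'w \<Rightarrow> int) \<Rightarrow> 'w \<Rightarrow> nat \<Rightarrow> int set" where
  "occupied n \<alpha> \<xi> \<omega> 0 = {}"
| "occupied n \<alpha> \<xi> \<omega> (Suc i) = occupied n \<alpha> \<xi> \<omega> i \<union>
     set_option (parking_spot n (occupied n \<alpha> \<xi> \<omega> i) (\<lambda>t. walk \<alpha> \<xi> (Suc i) t \<omega>))"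

definition parks :: "nat \<Rightarrow> (nat \<Rightarrow> nat) \<Rightarrow> (nat \<Rightarrow> nat \<Rightarrow> 'w \<Rightarrow> int) \<Rightarrow> nat \<Rightarrow> 'w \<Rightarrow> nat" where
  "parks n \<alpha> \<xi> i \<omega> =
     of_bool (parking_spot n (occupied n \<alpha> \<xi> \<omega> (i - 1)) (\<lambda>t. walk \<alpha> \<xi> i t \<omega>) \<noteq> None)"

text \<open>The infimum of the empty set is \<open>\<infinity>\<close>.\<close>

definition hit_time :: "(nat \<Rightarrow> nat) \<Rightarrow> (nat \<Rightarrow> nat \<Rightarrow> 'w \<Rightarrow> int) \<Rightarrow> nat \<Rightarrow> 'w \<Rightarrow> enat" where
  "hit_time \<alpha> \<xi> i \<omega> = (INF t \<in> {t. walk \<alpha> \<xi> i t \<omega> = int i \<or> walk \<alpha> \<xi> i t \<omega> = 0}. enat t)"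

text \<open>Expectation of a random time conditional on an event, i.e. under the conditional
  probability measure given that event. It is \<open>ereal\<close>-valued, so an equation with a real number
  includes finiteness.\<close>

definition cond_expect_time :: "'w measure \<Rightarrow> ('w \<Rightarrow> enat) \<Rightarrow> ('w \<Rightarrow> bool) \<Rightarrow> ereal" where
  "cond_expect_time M T Q =
     enn2ereal (\<integral>\<^sup>+ \<omega>. ennreal_of_enat (T \<omega>) \<partial>uniform_measure M {\<omega> \<in> space M. Q \<omega>})"

end

theory Submission
  imports Defs
begin

text \<open>If cars \<open>1, \<dots>, i - 1\<close> have all parked, they fill the block of spots \<open>1, \<dots>, i - 1\<close>, and car \<open>i\<close>,
  starting in or next to this block, parks if and only if its walk reaches \<open>i\<close> before \<open>0\<close>
  (\<open>all_park_iff\<close>; this uses that almost surely all steps are \<open>1\<close> or \<open>- 1\<close>). Hence, up to a null set,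
  the event that the first \<open>k\<close> cars park is an intersection of one event for each car, and these
  events depend on disjoint families of independent steps. So conditioning on the earlier cars has
  no effect on car \<open>i\<close>, and both claims are the classical statements on gambler's ruin on
  \<open>{0, \<dots>, i}\<close>: the probability of leaving at \<open>i\<close>, and the mean duration given that this happens.

  The latter are obtained from the probabilities \<open>u t x\<close> of exit at the top at time \<open>t\<close> from start
  \<open>x\<close> (\<open>exit_prob\<close>). Conditioning on the first step gives a recursion for \<open>u\<close>
  (\<open>prob_exits_top_at\<close>). Summed over \<open>t\<close>, it says that \<open>h x = (\<Sum>t. u t x)\<close> is harmonic for the walk
  with \<open>h 0 = 0\<close>, \<open>h i = 1\<close>, and that \<open>g x = (\<Sum>t. t * u t x)\<close> satisfies
  \<open>g x = p * g (x + 1) + (1 - p) * g (x - 1) + h x\<close> with \<open>g 0 = g i = 0\<close>. The closed forms solve the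
  same boundary value problems, and a harmonic function with zero boundary values vanishes
  (\<open>harmonic_zero_boundary\<close>), which gives \<open>exit_prob_sums\<close> and \<open>weighted_time_sums\<close>. Convergence of
  the second series comes from an exponential supersolution (\<open>weighted_time_bound\<close>). The conditional
  mean duration is \<open>g x / h x\<close>.\<close>

section \<open>Gambler's ruin by first-step analysis\<close>

text \<open>The probability that a walk with right-step probability \<open>p\<close>, started at \<open>x\<close>, leaves the open
  interval from \<open>0\<close> to \<open>k\<close> exactly at time \<open>t\<close> and at the end \<open>k\<close>. It is introduced by first-step
  analysis, which is the form in which both the summation over \<open>t\<close> and the link with random walks
  (\<open>prob_exits_top_at\<close> below) are proved by induction.\<close>

fun exit_prob :: "real \<Rightarrow> nat \<Rightarrow> nat \<Rightarrow> nat \<Rightarrow> real" where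
  "exit_prob p k 0 x = of_bool (x = k)"
| "exit_prob p k (Suc t) x =
     (if 0 < x \<and> x < k
      then p * exit_prob p k t (x + 1) + (1 - p) * exit_prob p k t (x - 1) else 0)"

text \<open>The gambler's ruin probability of reaching \<open>k\<close> before \<open>0\<close>; at \<open>p = 0\<close> and
  \<open>0 < k\<close> the convention \<open>0 ^ 0 = 1\<close> yields the value \<open>1\<close> for \<open>x = k\<close> and \<open>0\<close> for \<open>x < k\<close>.\<close>

definition reach_prob :: "real \<Rightarrow> nat \<Rightarrow> nat \<Rightarrow> real" where
  "reach_prob p k x =
     (if p = 1 / 2 then real x / real k
      else p ^ (k - x) * ((p ^ x - (1 - p) ^ x) / (p ^ k - (1 - p) ^ k)))"

text \<open>The expected duration of the same game given that it ends at \<open>k\<close>. The formula is meaningful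
  for \<open>0 < p\<close> and \<open>0 < x\<close> only.\<close>

definition reach_time :: "real \<Rightarrow> nat \<Rightarrow> nat \<Rightarrow> real" where
  "reach_time p k x =
     (if p = 1 / 2 then 1 / 3 * ((real k)\<^sup>2 - (real x)\<^sup>2)
      else 1 / (p - (1 - p)) *
        (real k * (1 + ((1 - p) / p) ^ k) / (1 - ((1 - p) / p) ^ k)
         - real x * (1 + ((1 - p) / p) ^ x) / (1 - ((1 - p) / p) ^ x)))"

lemma exit_prob_nonneg: "0 \<le> p \<Longrightarrow> p \<le> 1 \<Longrightarrow> 0 \<le> exit_prob p k t x"
  by (induction t arbitrary: x) auto

text \<open>Inside the interval a partial sum of length \<open>N + 1\<close> is a convex combination of two partial
  sums of length \<open>N\<close>; on the boundary at most the term at time \<open>0\<close> survives.\<close>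

lemma sum_exit_prob_le_1:
  assumes "0 \<le> p" "p \<le> 1"
  shows "(\<Sum>t<N. exit_prob p k t x) \<le> 1"
proof (induction N arbitrary: x)
  case (Suc N)
  have split: "(\<Sum>t<Suc N. exit_prob p k t x) =
      of_bool (x = k) + (\<Sum>t<N. exit_prob p k (Suc t) x)"
    by (subst sum.lessThan_Suc_shift) simp
  show ?case
  proof (cases "0 < x \<and> x < k")
    case True
    have "(\<Sum>t<N. exit_prob p k (Suc t) x) =
        p * (\<Sum>t<N. exit_prob p k t (x + 1)) + (1 - p) * (\<Sum>t<N. exit_prob p k t (x - 1))"
      using True by (simp add: sum.distrib sum_distrib_left)
    also have "\<dots> \<le> 1"
      by (rule convex_bound_le) (use Suc assms in auto)
    finally show ?thesis using split True by simp
  next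
    case False
    then show ?thesis unfolding split by auto
  qed
qed simp

lemma summable_exit_prob:
  assumes "0 \<le> p" "p \<le> 1"
  shows "summable (\<lambda>t. exit_prob p k t x)"
  by (rule summableI_nonneg_bounded[where x = 1])
    (use assms sum_exit_prob_le_1 exit_prob_nonneg in auto)

text \<open>For \<open>p > 0\<close> the increments of a function that is harmonic for the walk form a geometric
  progression with ratio \<open>(1 - p) / p \<ge> 0\<close>, so they are nonnegative multiples of the first one; as
  they add up to zero over the interval, the first one vanishes. For \<open>p = 0\<close> the function just
  propagates its value at \<open>0\<close>. This is the uniqueness principle that identifies both series
  below with their closed forms.\<close>

lemma harmonic_zero_boundary:
  fixes e :: "nat \<Rightarrow> real"
  assumes p: "0 \<le> p" "p \<le> 1"
    and e0: "e 0 = 0" and ek: "e k = 0"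
    and harm: "\<And>x. 0 < x \<Longrightarrow> x < k \<Longrightarrow> e x = p * e (x + 1) + (1 - p) * e (x - 1)"
    and "x \<le> k"
  shows "e x = 0"
proof (cases "p = 0")
  case True
  have "e y = 0" if "y < k" for y
    using that by (induction y) (use e0 harm[of "Suc _"] True in auto)
  then show ?thesis using ek \<open>x \<le> k\<close> by (cases "x = k") auto
next
  case False
  define r where "r = (1 - p) / p"
  have r: "0 \<le> r" and pr: "p * r = 1 - p" using False assms by (auto simp: r_def)
  have inc: "e (Suc y) - e y = r ^ y * e 1" if "y < k" for y
    using that
  proof (induction y)
    case 0 then show ?case using e0 by simp
  next
    case (Suc y)
    have "p * (e (Suc (Suc y)) - e (Suc y)) = (1 - p) * (e (Suc y) - e y)"
      using harm[of "Suc y"] Suc.prems by (simp add: algebra_simps)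
    also have "\<dots> = p * (r * (e (Suc y) - e y))" using pr by (simp add: mult.assoc[symmetric])
    finally have "e (Suc (Suc y)) - e (Suc y) = r * (e (Suc y) - e y)" using False by simp
    then show ?case using Suc by simp
  qed
  have e_eq: "e y = (\<Sum>z<y. r ^ z) * e 1" if "y \<le> k" for y
    using that
  proof (induction y)
    case 0 then show ?case using e0 by simp
  next
    case (Suc y)
    then show ?case using inc[of y] by (simp add: algebra_simps)
  qed
  show ?thesis
  proof (cases "k = 0")
    case True then show ?thesis using e0 \<open>x \<le> k\<close> by simp
  next
    case False
    have "(\<Sum>z<k. r ^ z) \<ge> (\<Sum>z\<in>{0::nat}. r ^ z)"
      by (rule sum_mono2) (use False r in auto)
    then have "(\<Sum>z<k. r ^ z) > 0" by simp
    then have "e 1 = 0" using e_eq[of k] ek by auto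
    then show ?thesis using e_eq[OF \<open>x \<le> k\<close>] by simp
  qed
qed

lemma power_eq_power_half:
  fixes p :: real
  assumes "0 \<le> p" "p \<le> 1" "0 < k" "p ^ k = (1 - p) ^ k"
  shows "p = 1 / 2"
  using power_eq_iff_eq_base[of k p "1 - p"] assms by auto

lemma reach_prob_top: "0 < k \<Longrightarrow> 0 \<le> p \<Longrightarrow> p \<le> 1 \<Longrightarrow> reach_prob p k k = 1"
  using power_eq_power_half[of p k] by (auto simp: reach_prob_def)

lemma reach_prob_0 [simp]: "reach_prob p k 0 = 0"
  by (simp add: reach_prob_def)

text \<open>For \<open>p \<noteq> 1 / 2\<close> and \<open>q = 1 - p\<close> the numerator is \<open>p ^ k - p ^ (k - x) * q ^ x\<close>, and passing
  from \<open>x\<close> to a neighbour moves one factor between \<open>p\<close> and \<open>q\<close>. Written in this way, without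
  the quotient \<open>q / p\<close>, the identity covers \<open>p = 0\<close>.\<close>

lemma reach_prob_harmonic:
  assumes "0 < x" "x < k"
  shows "reach_prob p k x = p * reach_prob p k (x + 1) + (1 - p) * reach_prob p k (x - 1)"
proof (cases "p = 1 / 2")
  case True
  then show ?thesis using assms by (simp add: reach_prob_def field_simps)
next
  case False
  \<comment> \<open>Exponents are shifted to avoid truncated subtraction in the polynomial identity.\<close>
  define d where "d = k - x - 1"
  obtain y where y: "x = Suc y" using assms(1) gr0_implies_Suc by blast
  have k: "k = x + d + 1" using assms by (simp add: d_def)
  define q where "q = 1 - p"
  define N where "N z = p ^ (k - z) * (p ^ z - q ^ z)" for z
  have e: "k - x = Suc d" "k - (x + 1) = d" "k - (x - 1) = Suc (Suc d)" using k y by auto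
  have "N x = p * N (x + 1) + (1 - p) * N (x - 1)"
  proof -
    have alg: "p * a * (p * b - q * c) = p * (a * (p * (p * b) - q * (q * c))) + (1 - p) * (p * (p * a) * (b - c))"
      for a b c :: real
      by (simp add: q_def algebra_simps)
    show ?thesis using alg[of "p ^ d" "p ^ y" "q ^ y"] unfolding N_def e by (simp add: y)
  qed
  moreover have "reach_prob p k z = N z / (p ^ k - q ^ k)" for z
    using False by (simp add: reach_prob_def N_def q_def)
  ultimately show ?thesis by (simp add: add_divide_distrib)
qed

text \<open>Summing the first-step recursion over \<open>t\<close> shows that the total is harmonic with boundary values
  \<open>0\<close> and \<open>1\<close>, as is \<open>reach_prob\<close>.\<close>

lemma exit_prob_sums:
  assumes p: "0 \<le> p" "p \<le> 1" and k: "0 < k" "x \<le> k"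
  shows "(\<lambda>t. exit_prob p k t x) sums reach_prob p k x"
proof -
  define h where "h x = (\<Sum>t. exit_prob p k t x)" for x
  have h_sums: "(\<lambda>t. exit_prob p k t x) sums h x" for x
    unfolding h_def using summable_exit_prob[OF p] by (rule summable_sums)
  have h_step: "h y = of_bool (y = k) + (\<Sum>t. exit_prob p k (Suc t) y)" for y
    unfolding h_def using suminf_split_head[OF summable_exit_prob[OF p], of k y] by simp
  have h_harm: "h y = p * h (y + 1) + (1 - p) * h (y - 1)" if "0 < y" "y < k" for y
  proof -
    have "(\<lambda>t. exit_prob p k (Suc t) y) sums (p * h (y + 1) + (1 - p) * h (y - 1))"
      using that by (auto intro!: sums_add sums_mult h_sums)
    then show ?thesis using h_step[of y] that by (simp add: sums_iff)
  qed
  have "h x - reach_prob p k x = 0"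
  proof (rule harmonic_zero_boundary[where e = "\<lambda>x. h x - reach_prob p k x" and p = p and k = k])
    show "h 0 - reach_prob p k 0 = 0" using h_step[of 0] k by simp
    show "h k - reach_prob p k k = 0" using h_step[of k] k p by (simp add: reach_prob_top)
    show "h y - reach_prob p k y = p * (h (y + 1) - reach_prob p k (y + 1))
        + (1 - p) * (h (y - 1) - reach_prob p k (y - 1))" if "0 < y" "y < k" for y
      using h_harm[OF that] reach_prob_harmonic[OF that, of p] by (simp add: algebra_simps)
  qed (use p k in auto)
  then show ?thesis using h_sums[of x] by simp
qed

lemma reach_prob_pos:
  assumes p: "0 < p" "p \<le> 1" and x: "0 < x" "x \<le> k"
  shows "0 < reach_prob p k x"
  using x(2,1)
proof (induction x rule: inc_induct)
  case base then show ?case using p by (simp add: reach_prob_top)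
next
  case (step x)
  have "0 \<le> reach_prob p k (x - 1)"
    using sums_le[OF _ sums_zero exit_prob_sums[of p k "x - 1"]] p step exit_prob_nonneg[of p k]
    by auto
  then have "0 < p * reach_prob p k (x + 1) + (1 - p) * reach_prob p k (x - 1)"
    using p step by (intro add_pos_nonneg) auto
  then show ?case using reach_prob_harmonic[of x k p] step by simp
qed

text \<open>With \<open>K = 2 / p\<close>, the function \<open>K ^ k - K ^ x\<close> is nonnegative and drops in mean by at least \<open>1\<close> in
  each step inside the interval, since \<open>p * K - 1 = 1\<close>. Hence it dominates the mean time up to
  exit, and in particular the part of it carried by the exits at \<open>k\<close>. This gives the
  convergence of the series in \<open>weighted_time_sums\<close>.\<close>

lemma weighted_time_bound:
  assumes p: "0 < p" "p \<le> 1" and "x \<le> k"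
  shows "(\<Sum>t<N. real t * exit_prob p k t x) \<le> (2 / p) ^ k - (2 / p) ^ x"
  using \<open>x \<le> k\<close>
proof (induction N arbitrary: x)
  case 0
  then show ?case using p by (simp add: power_increasing)
next
  case (Suc N)
  have K: "1 \<le> 2 / p" using p by simp
  have split: "(\<Sum>t<Suc N. real t * exit_prob p k t x) =
      (\<Sum>t<N. real (Suc t) * exit_prob p k (Suc t) x)"
    by (subst sum.lessThan_Suc_shift) simp
  show ?case
  proof (cases "0 < x \<and> x < k")
    case False
    then show ?thesis unfolding split using Suc.prems K by (auto simp: power_increasing)
  next
    case True
    \<comment> \<open>The mean drop of \<open>w\<close> pays for the unit of time spent on the first step.\<close>
    define w where "w y = (2 / p) ^ k - (2 / p) ^ y" for y
    obtain y where y: "x = Suc y" using True gr0_implies_Suc by blast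
    have "(\<Sum>t<N. real (Suc t) * exit_prob p k (Suc t) x) =
        p * (\<Sum>t<N. real t * exit_prob p k t (x + 1))
        + (1 - p) * (\<Sum>t<N. real t * exit_prob p k t (x - 1))
        + (\<Sum>t<N. exit_prob p k (Suc t) x)"
      unfolding sum_distrib_left sum.distrib[symmetric]
      by (rule sum.cong) (use True in \<open>auto simp: algebra_simps\<close>)
    moreover have "(\<Sum>t<N. exit_prob p k (Suc t) x) \<le> 1"
      using sum_exit_prob_le_1[OF less_imp_le[OF p(1)] p(2), of k x "Suc N"] True
      by (simp add: sum.lessThan_Suc_shift del: sum.lessThan_Suc exit_prob.simps(2))
    moreover have "p * (\<Sum>t<N. real t * exit_prob p k t (x + 1)) \<le> p * w (x + 1)"
      unfolding w_def using Suc.IH[of "x + 1"] True p by (intro mult_left_mono) auto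
    moreover have "(1 - p) * (\<Sum>t<N. real t * exit_prob p k t (x - 1)) \<le> (1 - p) * w (x - 1)"
      unfolding w_def using Suc.IH[of "x - 1"] True p by (intro mult_left_mono) auto
    moreover have "p * w (x + 1) + (1 - p) * w (x - 1) + 1 \<le> w x"
    proof -
      have "p * w (x + 1) + (1 - p) * w (x - 1) =
          (2 / p) ^ k - 2 * (2 / p) ^ x - (1 - p) * (2 / p) ^ (x - 1)"
        using p by (simp add: w_def algebra_simps)
      moreover have "1 \<le> (2 / p) ^ x" using K by simp
      moreover have "0 \<le> (1 - p) * (2 / p) ^ (x - 1)" using p by simp
      ultimately show ?thesis by (simp add: w_def)
    qed
    ultimately show ?thesis unfolding split w_def by linarith
  qed
qed

lemma summable_weighted_time:
  assumes "0 < p" "p \<le> 1" "x \<le> k"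
  shows "summable (\<lambda>t. real t * exit_prob p k t x)"
  by (rule summableI_nonneg_bounded[where x = "(2 / p) ^ k - (2 / p) ^ x"])
    (use assms weighted_time_bound exit_prob_nonneg in auto)

text \<open>The product of \<open>reach_prob\<close> and \<open>reach_time\<close>, that is, the mean of the exit time over the walks
  that exit at \<open>k\<close>. Cancelling \<open>1 - r ^ x\<close> gives an expression that also has the right value at
  \<open>x = 0\<close>, where \<open>reach_time\<close> is \<open>0 / 0\<close>; the recursion at \<open>x = 1\<close> needs this boundary value.\<close>

definition restricted_time :: "real \<Rightarrow> nat \<Rightarrow> nat \<Rightarrow> real" where
  "restricted_time p k x =
     (if p = 1 / 2 then real x * ((real k)\<^sup>2 - (real x)\<^sup>2) / (3 * real k)
      else (let r = (1 - p) / p in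
        (real k * (1 + r ^ k) / (1 - r ^ k) * (1 - r ^ x) - real x * (1 + r ^ x))
        / ((2 * p - 1) * (1 - r ^ k))))"

lemma ratio_power_ne_1:
  fixes p :: real
  assumes "0 < p" "p \<le> 1" "p \<noteq> 1 / 2" "0 < k"
  shows "((1 - p) / p) ^ k \<noteq> 1"
  using power_eq_power_half[of p k] assms by (auto simp: power_divide)

lemma reach_prob_ratio:
  assumes "0 < p" "p \<le> 1" "p \<noteq> 1 / 2" "x \<le> k"
  shows "reach_prob p k x = (1 - ((1 - p) / p) ^ x) / (1 - ((1 - p) / p) ^ k)"
proof -
  have nz: "p ^ x \<noteq> 0" "p ^ k \<noteq> 0" using assms by auto
  have "p ^ (k - x) * (p ^ x - (1 - p) ^ x) = p ^ k * (1 - ((1 - p) / p) ^ x)"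
  proof -
    have "p ^ k = p ^ (k - x) * p ^ x" using \<open>x \<le> k\<close> by (simp add: power_add[symmetric])
    then show ?thesis using nz by (simp add: power_divide field_simps)
  qed
  moreover have "p ^ k - (1 - p) ^ k = p ^ k * (1 - ((1 - p) / p) ^ k)"
    using nz by (simp add: power_divide field_simps)
  ultimately show ?thesis using assms nz by (simp add: reach_prob_def)
qed

lemma restricted_time_eq:
  assumes "0 < p" "p \<le> 1" "0 < x" "x \<le> k"
  shows "restricted_time p k x = reach_prob p k x * reach_time p k x"
proof (cases "p = 1 / 2")
  case True
  then show ?thesis using assms by (simp add: restricted_time_def reach_prob_def reach_time_def)
next
  case False
  have alg: "(C * (1 - a) - X * (1 + a)) / (d * b) = (1 - a) / b * (1 / d * (C - X * (1 + a) / (1 - a)))"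
    if "a \<noteq> 1" for C a X d b :: real
  proof -
    have "C - X * (1 + a) / (1 - a) = (C * (1 - a) - X * (1 + a)) / (1 - a)"
      using that by (simp add: field_simps)
    then show ?thesis using that by simp
  qed
  have "((1 - p) / p) ^ x \<noteq> 1" using ratio_power_ne_1 False assms by simp
  moreover have "p - (1 - p) = 2 * p - 1" by simp
  ultimately show ?thesis
    unfolding reach_prob_ratio[OF assms(1,2) False assms(4)]
    by (simp only: restricted_time_def reach_time_def Let_def False if_False) (rule alg)
qed

text \<open>Writing \<open>restricted_time\<close> as \<open>(c * (1 - r ^ x) - x * (1 + r ^ x)) / D\<close>, the part with \<open>c\<close> is
  harmonic, and the defect of \<open>x * (1 + r ^ x)\<close> is a multiple of \<open>1 - r ^ x\<close>, hence of
  \<open>reach_prob\<close>. For \<open>p = 1 / 2\<close> the same role is played by the second difference of a cubic.\<close>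

lemma restricted_time_step:
  assumes p: "0 < p" "p \<le> 1" and x: "0 < x" "x < k"
  shows "restricted_time p k x = p * restricted_time p k (x + 1)
    + (1 - p) * restricted_time p k (x - 1) + reach_prob p k x"
proof -
  obtain y where y: "x = Suc y" using x gr0_implies_Suc by blast
  show ?thesis
  proof (cases "p = 1 / 2")
    case True
    have cubic: "X * (K\<^sup>2 - X\<^sup>2) / (3 * K) = 1 / 2 * ((X + 1) * (K\<^sup>2 - (X + 1)\<^sup>2) / (3 * K))
        + 1 / 2 * ((X - 1) * (K\<^sup>2 - (X - 1)\<^sup>2) / (3 * K)) + X / K" if "K > 0" for X K :: real
      using that by (simp add: field_simps power2_eq_square)
    show ?thesis unfolding True restricted_time_def reach_prob_def
      using cubic[of "real k" "real x"] x y by simp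
  next
    case False
    define r where "r = (1 - p) / p"
    define c where "c = real k * (1 + r ^ k) / (1 - r ^ k)"
    define D where "D = (2 * p - 1) * (1 - r ^ k)"
    have rk: "1 - r ^ k \<noteq> 0" using ratio_power_ne_1[of p k] p False x by (simp add: r_def)
    have D: "D \<noteq> 0" using rk False by (simp add: D_def)
    have pr: "p * r = 1 - p" using p by (simp add: r_def)
    have T: "restricted_time p k z = (c * (1 - r ^ z) - real z * (1 + r ^ z)) / D" for z
      using False by (simp add: restricted_time_def c_def D_def r_def Let_def)
    have R: "reach_prob p k x = (2 * p - 1) * (1 - r ^ x) / D"
      using reach_prob_ratio[of p x k] p False x rk by (simp add: r_def D_def)
    have "c * (1 - r ^ x) - real x * (1 + r ^ x) =
       p * (c * (1 - r ^ (x + 1)) - real (x + 1) * (1 + r ^ (x + 1)))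
       + (1 - p) * (c * (1 - r ^ (x - 1)) - real (x - 1) * (1 + r ^ (x - 1)))
       + (2 * p - 1) * (1 - r ^ x)"
    proof -
      have alg: "c * (1 - r * a) - (Y + 1) * (1 + r * a) =
          p * (c * (1 - r * (r * a)) - (Y + 2) * (1 + r * (r * a)))
          + (1 - p) * (c * (1 - a) - Y * (1 + a)) + (2 * p - 1) * (1 - r * a)"
        if "p * r = 1 - p" for a Y c p r :: real
        using that by algebra
      show ?thesis using alg[OF pr, of c "r ^ y" "real y"] by (simp add: y add.commute)
    qed
    then show ?thesis unfolding T R using D
      by (simp add: add_divide_distrib[symmetric])
  qed
qed

text \<open>Replacing \<open>t\<close> by \<open>t + 1\<close> in the weighted series and applying the first-step recursion gives the
  harmonic equation with the inhomogeneous term \<open>reach_prob\<close>, and zero boundary values.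
  \<open>restricted_time\<close> solves the same problem, so the difference is harmonic and vanishes.\<close>

lemma weighted_time_sums:
  assumes p: "0 < p" "p \<le> 1" and x: "0 < x" "x \<le> k"
  shows "(\<lambda>t. real t * exit_prob p k t x) sums (reach_prob p k x * reach_time p k x)"
proof -
  have p': "0 \<le> p" using p by simp
  define g where "g x = (\<Sum>t. real t * exit_prob p k t x)" for x
  have g_sums: "(\<lambda>t. real t * exit_prob p k t y) sums g y" if "y \<le> k" for y
    unfolding g_def using summable_weighted_time[OF p that] by (rule summable_sums)
  have g_step: "(\<lambda>t. real (Suc t) * exit_prob p k (Suc t) y) sums g y" if "y \<le> k" for y
    using g_sums[OF that] by (subst sums_Suc_iff) simp
  have g_boundary: "g y = 0" if "y = 0 \<or> y = k" for y
    using g_step[of y] that sums_unique2[OF _ sums_zero] by auto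
  have g_eq: "g y = p * g (y + 1) + (1 - p) * g (y - 1) + reach_prob p k y"
    if y: "0 < y" "y < k" for y
  proof -
    have "(\<lambda>t. exit_prob p k (Suc t) y) sums reach_prob p k y"
      using exit_prob_sums[OF p' p(2), of k y] y by (subst sums_Suc_iff) simp
    then have "(\<lambda>t. p * (real t * exit_prob p k t (y + 1))
        + (1 - p) * (real t * exit_prob p k t (y - 1)) + exit_prob p k (Suc t) y)
        sums (p * g (y + 1) + (1 - p) * g (y - 1) + reach_prob p k y)"
      using y by (intro sums_add sums_mult g_sums) auto
    also have "(\<lambda>t. p * (real t * exit_prob p k t (y + 1))
        + (1 - p) * (real t * exit_prob p k t (y - 1)) + exit_prob p k (Suc t) y) =
        (\<lambda>t. real (Suc t) * exit_prob p k (Suc t) y)"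
      using y by (auto simp: algebra_simps)
    finally show ?thesis using g_step[of y] y sums_unique2 by fastforce
  qed
  have "g x - restricted_time p k x = 0"
  proof (rule harmonic_zero_boundary[where e = "\<lambda>x. g x - restricted_time p k x" and p = p and k = k])
    show "g 0 - restricted_time p k 0 = 0"
      using g_boundary[of 0] by (simp add: restricted_time_def)
    show "g k - restricted_time p k k = 0"
      using g_boundary[of k] restricted_time_eq[of p k k] p x by (simp add: reach_time_def)
    show "g y - restricted_time p k y = p * (g (y + 1) - restricted_time p k (y + 1))
        + (1 - p) * (g (y - 1) - restricted_time p k (y - 1))" if "0 < y" "y < k" for y
      using g_eq[OF that] restricted_time_step[OF p that] by (simp add: algebra_simps)
  qed (use p x in auto)
  then show ?thesis using g_sums[of x] restricted_time_eq[OF p x] x by simp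
qed

section \<open>Trajectories and the parking rule\<close>

definition trajectory :: "int \<Rightarrow> (nat \<Rightarrow> int) \<Rightarrow> nat \<Rightarrow> int" where
  "trajectory x f t = x + (\<Sum>s<t. f s)"

text \<open>The start may already be at \<open>k\<close>, in which case the exit happens at time \<open>0\<close>; for \<open>k = 1\<close> the
  interval is empty and this is the only possible exit.\<close>

definition exits_top_at :: "nat \<Rightarrow> (nat \<Rightarrow> int) \<Rightarrow> nat \<Rightarrow> bool" where
  "exits_top_at k z t \<longleftrightarrow> z t = int k \<and> (\<forall>s<t. z s \<in> {1..<int k})"

lemma exits_top_at_unique: "exits_top_at k z s \<Longrightarrow> exits_top_at k z t \<Longrightarrow> s = t"
  by (cases s t rule: linorder_cases) (auto simp: exits_top_at_def)

lemma trajectory_0 [simp]: "trajectory x f 0 = x"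
  by (simp add: trajectory_def)

lemma trajectory_Suc: "trajectory x f (Suc t) = trajectory (x + f 0) (\<lambda>s. f (Suc s)) t"
  by (simp add: trajectory_def sum.lessThan_Suc_shift del: sum.lessThan_Suc)

text \<open>The pathwise counterpart of the recursion for \<open>exit_prob\<close>.\<close>

lemma exits_top_at_trajectory_Suc:
  "exits_top_at k (trajectory x f) (Suc t) \<longleftrightarrow>
     x \<in> {1..<int k} \<and> exits_top_at k (trajectory (x + f 0) (\<lambda>s. f (Suc s))) t"
  by (auto simp: exits_top_at_def trajectory_Suc less_Suc_eq_0_disj)

lemma first_exit_position:
  fixes z :: "nat \<Rightarrow> int"
  assumes start: "1 \<le> z 0" "z 0 \<le> int (Suc k)"
    and steps: "\<And>t. \<bar>z (Suc t) - z t\<bar> \<le> 1"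
    and t: "z t \<notin> {1..int k}" and before: "\<And>s. s < t \<Longrightarrow> z s \<in> {1..int k}"
  shows "z t = 0 \<or> z t = int (Suc k)"
proof (cases t)
  case 0
  then show ?thesis using start t by auto
next
  case (Suc s)
  then show ?thesis using before[of s] steps[of s] t by auto
qed

lemma parking_spot_mem: "parking_spot n S z = Some x \<Longrightarrow> x \<in> {1..int n}"
  by (auto simp: parking_spot_def Let_def split: if_splits)

text \<open>A walk that moves by at most one cannot jump over the end points, so its first position outside
  \<open>{1..k}\<close> is \<open>0\<close> or \<open>k + 1\<close>. The first of these is the open boundary, the second one is the
  nearest free spot.\<close>

lemma parking_spot_interval:
  assumes "Suc k \<le> n" and start: "1 \<le> z 0" "z 0 \<le> int (Suc k)"
    and steps: "\<And>t. \<bar>z (Suc t) - z t\<bar> \<le> 1"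
  shows "parking_spot n {1..int k} z =
    (if \<exists>t. exits_top_at (Suc k) z t then Some (int (Suc k)) else None)"
proof -
  have ends: "search_ends n {1..int k} x \<longleftrightarrow> x \<notin> {1..int k}" for x
    using assms(1) by (auto simp: search_ends_def)
  have E: "exits_top_at (Suc k) z t \<longleftrightarrow> z t = int (Suc k) \<and> (\<forall>s<t. z s \<in> {1..int k})" for t
    by (auto simp: exits_top_at_def)
  show ?thesis
  proof (cases "\<exists>t. z t \<notin> {1..int k}")
    case False
    then have "\<not> exits_top_at (Suc k) z t" for t by (auto simp: E dest: spec[of _ t])
    then show ?thesis using False by (simp add: parking_spot_def ends)
  next
    case True
    define T where "T = (LEAST t. z t \<notin> {1..int k})"
    have T: "z T \<notin> {1..int k}" unfolding T_def using True by (rule LeastI_ex)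
    have before: "z s \<in> {1..int k}" if "s < T" for s
      using not_less_Least[of s "\<lambda>t. z t \<notin> {1..int k}"] that by (auto simp: T_def)
    have iff: "(\<exists>t. exits_top_at (Suc k) z t) \<longleftrightarrow> z T = int (Suc k)"
    proof
      assume "\<exists>t. exits_top_at (Suc k) z t"
      then obtain t where t: "z t = int (Suc k)" "\<And>s. s < t \<Longrightarrow> z s \<in> {1..int k}"
        unfolding E by auto
      have "t = T" using t T before[of t] by (cases t T rule: linorder_cases) auto
      then show "z T = int (Suc k)" using t by simp
    next
      assume "z T = int (Suc k)"
      then show "\<exists>t. exits_top_at (Suc k) z t" unfolding E using before by blast
    qed
    have "parking_spot n {1..int k} z = (if z T \<in> {1..int n} then Some (z T) else None)"
      using True by (simp add: parking_spot_def ends T_def Let_def)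
    then show ?thesis
      using iff first_exit_position[of z k T] start steps T before assms(1) by auto
  qed
qed

lemma walk_eq_trajectory: "walk \<alpha> \<xi> j t \<omega> = trajectory (int (\<alpha> j)) (\<lambda>s. \<xi> j s \<omega>) t"
  by (simp add: walk_def trajectory_def)

lemma prod_parks_eq_1:
  "(\<Prod>j = 1..k. parks n \<alpha> \<xi> j \<omega>) = 1 \<longleftrightarrow> (\<forall>j\<in>{1..k}. parks n \<alpha> \<xi> j \<omega> = 1)"
  by (subst prod_eq_1_iff) auto

text \<open>As long as every car has parked, car \<open>k + 1\<close> meets exactly the occupied block \<open>{1..k}\<close> and can
  only extend it by \<open>k + 1\<close>. So the joint event splits into one condition per car, each involving
  the steps of that car alone; the occupied set is carried through the induction for this purpose.\<close>

lemma all_park_iff: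
  assumes steps: "\<And>j t. j \<in> {1..n} \<Longrightarrow> \<bar>\<xi> j t \<omega>\<bar> = 1"
    and pref: "\<And>j. j \<in> {1..n} \<Longrightarrow> 1 \<le> \<alpha> j \<and> \<alpha> j \<le> j"
    and "k \<le> n"
  shows "((\<forall>j\<in>{1..k}. parks n \<alpha> \<xi> j \<omega> = 1) \<longleftrightarrow>
      (\<forall>j\<in>{1..k}. \<exists>t. exits_top_at j (trajectory (int (\<alpha> j)) (\<lambda>s. \<xi> j s \<omega>)) t)) \<and>
    ((\<forall>j\<in>{1..k}. parks n \<alpha> \<xi> j \<omega> = 1) \<longrightarrow> occupied n \<alpha> \<xi> \<omega> k = {1..int k})"
  using \<open>k \<le> n\<close>
proof (induction k)
  case 0
  then show ?case by simp
next
  case (Suc k)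
  let ?z = "trajectory (int (\<alpha> (Suc k))) (\<lambda>s. \<xi> (Suc k) s \<omega>)"
  have mem: "Suc k \<in> {1..n}" using Suc.prems by simp
  have ins: "{1..Suc k} = insert (Suc k) {1..k}" by auto
  have spot: "parking_spot n {1..int k} (\<lambda>t. walk \<alpha> \<xi> (Suc k) t \<omega>) =
      (if \<exists>t. exits_top_at (Suc k) ?z t then Some (int (Suc k)) else None)"
    unfolding walk_eq_trajectory
  proof (rule parking_spot_interval)
    show "Suc k \<le> n" by (rule Suc.prems)
    show "1 \<le> ?z 0" "?z 0 \<le> int (Suc k)" using pref[OF mem] by simp_all
    show "\<bar>?z (Suc t) - ?z t\<bar> \<le> 1" for t using steps[OF mem, of t] by (simp add: trajectory_def)
  qed
  have P: "parks n \<alpha> \<xi> (Suc k) \<omega> = 1 \<longleftrightarrow> (\<exists>t. exits_top_at (Suc k) ?z t)"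
    if "occupied n \<alpha> \<xi> \<omega> k = {1..int k}"
    unfolding parks_def diff_Suc_1 that spot by simp
  have O: "occupied n \<alpha> \<xi> \<omega> (Suc k) = {1..int (Suc k)}"
    if "occupied n \<alpha> \<xi> \<omega> k = {1..int k}" "\<exists>t. exits_top_at (Suc k) ?z t"
  proof -
    have "occupied n \<alpha> \<xi> \<omega> (Suc k) = {1..int k} \<union> set_option (Some (int (Suc k)))"
      unfolding occupied.simps(2) that(1) spot using that(2) by (simp only: if_True)
    also have "\<dots> = {1..int (Suc k)}" by auto
    finally show ?thesis .
  qed
  have IH: "((\<forall>j\<in>{1..k}. parks n \<alpha> \<xi> j \<omega> = 1) \<longleftrightarrow>
      (\<forall>j\<in>{1..k}. \<exists>t. exits_top_at j (trajectory (int (\<alpha> j)) (\<lambda>s. \<xi> j s \<omega>)) t)) \<and>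
    ((\<forall>j\<in>{1..k}. parks n \<alpha> \<xi> j \<omega> = 1) \<longrightarrow> occupied n \<alpha> \<xi> \<omega> k = {1..int k})"
    by (rule Suc.IH[OF Suc_leD[OF Suc.prems]])
  \<comment> \<open>The induction step, with its statements abstracted to propositional variables.\<close>
  have logic: "((pk \<and> A) = (ex \<and> R)) \<and> (pk \<and> A \<longrightarrow> oc')"
    if "(A = R) \<and> (A \<longrightarrow> oc)" "oc \<Longrightarrow> pk = ex" "oc \<Longrightarrow> ex \<Longrightarrow> oc'" for A R oc pk ex oc' :: bool
    using that by blast
  show ?case unfolding ins Set.ball_simps(7) by (rule logic[OF IH P O])
qed

lemma hit_time_eq:
  assumes "exits_top_at i (trajectory (int (\<alpha> i)) (\<lambda>s. \<xi> i s \<omega>)) t"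
  shows "hit_time \<alpha> \<xi> i \<omega> = enat t"
  unfolding hit_time_def walk_eq_trajectory
proof (rule antisym)
  let ?z = "trajectory (int (\<alpha> i)) (\<lambda>s. \<xi> i s \<omega>)"
  have top: "?z t = int i" and before: "\<And>s. s < t \<Longrightarrow> ?z s \<in> {1..<int i}"
    using assms unfolding exits_top_at_def by blast+
  show "(INF t\<in>{t. ?z t = int i \<or> ?z t = 0}. enat t) \<le> enat t"
    by (rule INF_lower) (simp add: top)
  show "enat t \<le> (INF t\<in>{t. ?z t = int i \<or> ?z t = 0}. enat t)"
  proof (rule INF_greatest)
    fix s assume "s \<in> {t. ?z t = int i \<or> ?z t = 0}"
    then have "\<not> s < t" using before[of s] by force
    then show "enat t \<le> enat s" by simp
  qed
qed

section \<open>Measurability and independence of the steps\<close>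

lemma measurable_trajectory:
  fixes f :: "'a \<Rightarrow> nat \<Rightarrow> int"
  assumes f: "\<And>s. (\<lambda>\<omega>. f \<omega> s) \<in> measurable N (count_space UNIV)"
  shows "(\<lambda>\<omega>. trajectory x (f \<omega>) t) \<in> measurable N (count_space UNIV)"
proof (induction t)
  case 0
  show ?case by simp
next
  case (Suc t)
  have step: "(\<lambda>\<omega>. a + f \<omega> t) \<in> measurable N (count_space UNIV)" for a
    by (rule measurable_compose[OF f[of t], where g = "\<lambda>b. a + b"]) simp
  have "trajectory x (f \<omega>) (Suc t) = trajectory x (f \<omega>) t + f \<omega> t" for \<omega>
    by (simp add: trajectory_def)
  then show ?case
    by (simp only:) (rule measurable_compose_countable[OF step Suc])
qed

lemma pred_exits_top_at:
  fixes f :: "'a \<Rightarrow> nat \<Rightarrow> int"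
  assumes f: "\<And>s. (\<lambda>\<omega>. f \<omega> s) \<in> measurable N (count_space UNIV)"
  shows "Measurable.pred N (\<lambda>\<omega>. exits_top_at k (trajectory x (f \<omega>)) t)"
proof -
  have "Measurable.pred N (\<lambda>\<omega>. P (trajectory x (f \<omega>) s))" for P s
    by (rule measurable_compose[OF measurable_trajectory[OF f], where g = P]) simp
  then show ?thesis
    unfolding exits_top_at_def
    by (intro pred_intros_logic(3) pred_intros_countable(1) pred_intros_imp')
qed
context parking_steps
begin

lemma measurable_step:
  assumes "j \<in> {1..n}"
  shows "\<xi> j t \<in> measurable M (count_space UNIV)"
proof -
  have "\<forall>i\<in>{1..n} \<times> UNIV. (case i of (j, t) \<Rightarrow> \<xi> j t) \<in> measurable M (count_space UNIV)"
    using indep_steps unfolding indep_vars_def by blast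
  then show ?thesis using assms by fastforce
qed
text \<open>The two prescribed probabilities add up to one.\<close>

lemma AE_step:
  "AE \<omega> in M. \<forall>j\<in>{1..n}. \<forall>t. \<xi> j t \<omega> = 1 \<or> \<xi> j t \<omega> = - 1"
proof -
  have "AE \<omega> in M. \<xi> j t \<omega> = 1 \<or> \<xi> j t \<omega> = - 1" if j: "j \<in> {1..n}" for j t
  proof -
    have pred: "Measurable.pred M (\<lambda>\<omega>. \<xi> j t \<omega> = c)" for c
      by (rule measurable_compose[OF measurable_step[OF j]]) simp
    have "\<P>(\<omega> in M. \<xi> j t \<omega> = 1 \<or> \<xi> j t \<omega> = - 1) =
        prob ({\<omega> \<in> space M. \<xi> j t \<omega> = 1} \<union> {\<omega> \<in> space M. \<xi> j t \<omega> = - 1})"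
      by (rule arg_cong[where f = prob]) blast
    also have "\<dots> = \<P>(\<omega> in M. \<xi> j t \<omega> = 1) + \<P>(\<omega> in M. \<xi> j t \<omega> = - 1)"
      by (rule finite_measure_Union[OF predE[OF pred] predE[OF pred]]) force
    also have "\<dots> = 1" unfolding prob_right[OF j] prob_left[OF j] by simp
    finally show ?thesis
      using prob_Collect_eq_1[OF predE[OF pred_intros_logic(5)[OF pred pred]]] by blast
  qed
  then show ?thesis by (simp add: AE_ball_countable AE_all_countable)
qed

text \<open>Independence in the form used below: \<open>P\<close> and \<open>Q\<close> are properties of the whole family of steps
  which depend only on the coordinates in \<open>A\<close> and in \<open>B\<close>, respectively.\<close>

lemma prob_conj_disjoint_steps:
  assumes AB: "A \<inter> B = {}" "A \<subseteq> {1..n} \<times> UNIV" "B \<subseteq> {1..n} \<times> UNIV"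
    and P: "Measurable.pred (PiM A (\<lambda>_. count_space UNIV)) P" "\<And>f. P (restrict f A) = P f"
    and Q: "Measurable.pred (PiM B (\<lambda>_. count_space UNIV)) Q" "\<And>f. Q (restrict f B) = Q f"
  shows "\<P>(\<omega> in M. P (\<lambda>(j, t). \<xi> j t \<omega>) \<and> Q (\<lambda>(j, t). \<xi> j t \<omega>)) =
    \<P>(\<omega> in M. P (\<lambda>(j, t). \<xi> j t \<omega>)) * \<P>(\<omega> in M. Q (\<lambda>(j, t). \<xi> j t \<omega>))"
proof -
  let ?X = "\<lambda>\<omega> (j, t). \<xi> j t \<omega>"
  let ?N = "\<lambda>A. PiM A (\<lambda>_. count_space UNIV) :: (nat \<times> nat \<Rightarrow> int) measure"
  have X_eq: "(\<lambda>i. (case i of (j, t) \<Rightarrow> \<xi> j t) \<omega>) = ?X \<omega>" for \<omega>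
    by (auto simp: fun_eq_iff)
  have "indep_var (?N A) (\<lambda>\<omega>. restrict (?X \<omega>) A) (?N B) (\<lambda>\<omega>. restrict (?X \<omega>) B)"
    using indep_var_restrict[OF indep_steps AB] unfolding X_eq .
  from indep_varD[OF this, of "{f \<in> space (?N A). P f}" "{f \<in> space (?N B). Q f}"]
  have "prob ((\<lambda>\<omega>. (restrict (?X \<omega>) A, restrict (?X \<omega>) B)) -`
        ({f \<in> space (?N A). P f} \<times> {f \<in> space (?N B). Q f}) \<inter> space M) =
      prob ((\<lambda>\<omega>. restrict (?X \<omega>) A) -` {f \<in> space (?N A). P f} \<inter> space M) *
      prob ((\<lambda>\<omega>. restrict (?X \<omega>) B) -` {f \<in> space (?N B). Q f} \<inter> space M)"
    using P(1) Q(1) by simp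
  moreover have "(\<lambda>\<omega>. (restrict (?X \<omega>) A, restrict (?X \<omega>) B)) -`
        ({f \<in> space (?N A). P f} \<times> {f \<in> space (?N B). Q f}) \<inter> space M =
      {\<omega> \<in> space M. P (?X \<omega>) \<and> Q (?X \<omega>)}"
    "(\<lambda>\<omega>. restrict (?X \<omega>) A) -` {f \<in> space (?N A). P f} \<inter> space M = {\<omega> \<in> space M. P (?X \<omega>)}"
    "(\<lambda>\<omega>. restrict (?X \<omega>) B) -` {f \<in> space (?N B). Q f} \<inter> space M = {\<omega> \<in> space M. Q (?X \<omega>)}"
    by (auto simp: space_PiM P(2) Q(2) )
  ultimately show ?thesis by simp
qed

section \<open>The exit law of a single car\<close>

text \<open>The first step is independent of the later ones, and a walk driven by the later steps has the
  same exit probabilities. Stating the lemma for all time shifts \<open>m\<close> lets the induction hypothesis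
  express this without any appeal to identical distribution.\<close>

lemma prob_exits_top_at:
  assumes j: "j \<in> {1..n}"
  shows "\<P>(\<omega> in M. exits_top_at k (trajectory (int x) (\<lambda>s. \<xi> j (m + s) \<omega>)) t) = exit_prob p k t x"
proof (induction t arbitrary: x m)
  case 0
  show ?case by (auto simp: exits_top_at_def prob_space)
next
  case (Suc t)
  let ?E = "\<lambda>y \<omega>. exits_top_at k (trajectory (int y) (\<lambda>s. \<xi> j (Suc m + s) \<omega>)) t"
  let ?F = "\<lambda>\<omega>. exits_top_at k (trajectory (int x) (\<lambda>s. \<xi> j (m + s) \<omega>)) (Suc t)"
  let ?G = "\<lambda>c y. {\<omega> \<in> space M. \<xi> j m \<omega> = c \<and> ?E y \<omega>}"
  have F: "{\<omega> \<in> space M. ?F \<omega>} \<in> events"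
    by (rule predE, rule pred_exits_top_at, rule measurable_step[OF j])
  have E: "Measurable.pred M (?E y)" for y
    by (rule pred_exits_top_at, rule measurable_step[OF j])
  have step: "Measurable.pred M (\<lambda>\<omega>. \<xi> j m \<omega> = c)" for c
    by (rule measurable_compose[OF measurable_step[OF j]]) simp
  have G: "?G c y \<in> events" for c y
    by (rule predE, rule pred_intros_logic(3), rule step, rule E)
  have ind: "prob (?G c y) = \<P>(\<omega> in M. \<xi> j m \<omega> = c) * \<P>(\<omega> in M. ?E y \<omega>)" for c y
  proof -
    let ?B = "{j} \<times> {Suc m..}"
    have 1: "Measurable.pred (PiM {(j, m)} (\<lambda>_. count_space UNIV)) (\<lambda>f. f (j, m) = c)"
      by measurable
    have 2: "Measurable.pred (PiM ?B (\<lambda>_. count_space UNIV))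
        (\<lambda>f. exits_top_at k (trajectory (int y) (\<lambda>s. f (j, Suc m + s))) t)"
      by (rule pred_exits_top_at, rule measurable_component_singleton) auto
    have "?B \<subseteq> {1..n} \<times> UNIV" "{(j, m)} \<subseteq> {1..n} \<times> UNIV" using j by auto
    from prob_conj_disjoint_steps[OF _ this(2,1) 1 _ 2] show ?thesis by simp
  qed
  show ?case
  proof (cases "0 < x \<and> x < k")
    case False
    then have "\<not> ?F \<omega>" for \<omega>
      by (auto simp: exits_top_at_trajectory_Suc)
    then show ?thesis by (simp only: exit_prob.simps(2) False if_False) simp
  next
    case True
    have "prob {\<omega> \<in> space M. ?F \<omega>} = prob (?G 1 (x + 1) \<union> ?G (- 1) (x - 1))"
    proof (rule finite_measure_eq_AE)
      show "AE \<omega> in M. \<omega> \<in> {\<omega> \<in> space M. ?F \<omega>} \<longleftrightarrow> \<omega> \<in> ?G 1 (x + 1) \<union> ?G (- 1) (x - 1)"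
      proof (rule AE_mp[OF AE_step], rule AE_I2, rule impI)
        fix \<omega> assume \<omega>: "\<omega> \<in> space M"
          and pm: "\<forall>j\<in>{1..n}. \<forall>t. \<xi> j t \<omega> = 1 \<or> \<xi> j t \<omega> = - 1"
        have F_iff: "?F \<omega> \<longleftrightarrow>
            exits_top_at k (trajectory (int x + \<xi> j m \<omega>) (\<lambda>s. \<xi> j (Suc m + s) \<omega>)) t"
          using True by (simp add: exits_top_at_trajectory_Suc)
        consider "\<xi> j m \<omega> = 1" "int x + \<xi> j m \<omega> = int (x + 1)"
          | "\<xi> j m \<omega> = - 1" "int x + \<xi> j m \<omega> = int (x - 1)"
        proof -
          have "int x + 1 = int (x + 1)" "int x + (- 1) = int (x - 1)" using True by auto
          moreover have "\<xi> j m \<omega> = 1 \<or> \<xi> j m \<omega> = - 1" using pm j by blast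
          ultimately show thesis using that by metis
        qed
        then show "\<omega> \<in> {\<omega> \<in> space M. ?F \<omega>} \<longleftrightarrow> \<omega> \<in> ?G 1 (x + 1) \<union> ?G (- 1) (x - 1)"
        proof cases
          case 1
          then have "\<xi> j m \<omega> \<noteq> - 1" by simp
          moreover have "?F \<omega> \<longleftrightarrow> ?E (x + 1) \<omega>" unfolding F_iff 1(2) ..
          ultimately show ?thesis using 1(1) \<omega> by blast
        next
          case 2
          then have "\<xi> j m \<omega> \<noteq> 1" by simp
          moreover have "?F \<omega> \<longleftrightarrow> ?E (x - 1) \<omega>" unfolding F_iff 2(2) ..
          ultimately show ?thesis using 2(1) \<omega> by blast
        qed
      qed
    qed (use F G in blast)+
    also have "\<dots> = prob (?G 1 (x + 1)) + prob (?G (- 1) (x - 1))"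
    proof (rule finite_measure_Union[OF G G])
      show "?G 1 (x + 1) \<inter> ?G (- 1) (x - 1) = {}" by force
    qed
    also have "\<dots> = p * exit_prob p k t (x + 1) + (1 - p) * exit_prob p k t (x - 1)"
      unfolding ind Suc.IH prob_right[OF j] prob_left[OF j] ..
    finally show ?thesis using True by (simp only: exit_prob.simps(2) simp_thms if_True)
  qed
qed

section \<open>Measurability of the parking events\<close>

lemma measurable_walk:
  assumes "j \<in> {1..n}"
  shows "(\<lambda>\<omega>. walk \<alpha> \<xi> j t \<omega>) \<in> measurable M (count_space UNIV)"
  unfolding walk_eq_trajectory by (rule measurable_trajectory) (rule measurable_step[OF assms])

lemma measurable_parking_spot:
  assumes "j \<in> {1..n}"
  shows "(\<lambda>\<omega>. parking_spot n S (\<lambda>t. walk \<alpha> \<xi> j t \<omega>)) \<in> measurable M (count_space UNIV)"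
proof -
  have ends: "Measurable.pred M (\<lambda>\<omega>. search_ends n S (walk \<alpha> \<xi> j t \<omega>))" for t
    by (rule measurable_compose[OF measurable_walk[OF assms], where g = "search_ends n S"]) simp
  let ?L = "\<lambda>\<omega>. LEAST t. search_ends n S (walk \<alpha> \<xi> j t \<omega>)"
  have "?L \<in> measurable M (count_space UNIV)"
    by (rule measurable_Least[OF ends])
  from measurable_compose_countable[OF measurable_walk[OF assms] this]
  have end_pos: "(\<lambda>\<omega>. walk \<alpha> \<xi> j (?L \<omega>) \<omega>) \<in> measurable M (count_space UNIV)" .
  show ?thesis
    unfolding parking_spot_def Let_def
  proof (rule measurable_If)
    show "{\<omega> \<in> space M. \<exists>t. search_ends n S (walk \<alpha> \<xi> j t \<omega>)} \<in> sets M"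
      by (rule predE, rule pred_intros_countable(2), rule ends)
    show "(\<lambda>\<omega>. if walk \<alpha> \<xi> j (?L \<omega>) \<omega> \<in> {1..int n}
        then Some (walk \<alpha> \<xi> j (?L \<omega>) \<omega>) else None) \<in> measurable M (count_space UNIV)"
      by (rule measurable_compose[OF end_pos, where g = "\<lambda>x. if x \<in> {1..int n} then Some x else None"]) simp
  qed simp
qed

text \<open>The set of occupied spots takes finitely many values, so the random set in the search rule can be
  treated as a constant on each piece.\<close>

lemma measurable_occupied:
  assumes "k \<le> n"
  shows "(\<lambda>\<omega>. occupied n \<alpha> \<xi> \<omega> k) \<in> measurable M (count_space (Pow {1..int n}))"
  using assms
proof (induction k)
  case 0
  then show ?case by simp
next
  case (Suc k)
  let ?spot = "\<lambda>S \<omega>. parking_spot n S (\<lambda>t. walk \<alpha> \<xi> (Suc k) t \<omega>)"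
  have j: "Suc k \<in> {1..n}" using Suc.prems by simp
  have "(\<lambda>\<omega>. S \<union> set_option (?spot S \<omega>)) \<in> measurable M (count_space (Pow {1..int n}))"
    if "S \<in> Pow {1..int n}" for S
  proof (rule measurable_count_space_eq_countable[THEN iffD2], rule countable_finite, simp,
      intro conjI ballI Pi_I)
    show "S \<union> set_option (?spot S \<omega>) \<in> Pow {1..int n}" for \<omega>
      using that parking_spot_mem by fastforce
    show "(\<lambda>\<omega>. S \<union> set_option (?spot S \<omega>)) -` {a} \<inter> space M \<in> sets M" for a
      by (rule measurable_sets[OF measurable_compose[OF measurable_parking_spot[OF j],
            where g = "\<lambda>x. S \<union> set_option x" and L = "count_space UNIV"]]) simp_all
  qed
  moreover have "(\<lambda>\<omega>. occupied n \<alpha> \<xi> \<omega> k) \<in> measurable M (count_space (Pow {1..int n}))"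
    using Suc by simp
  ultimately show ?case
    unfolding occupied.simps(2)
    by (rule measurable_compose_countable') (simp_all add: countable_finite)
qed

lemma pred_parks:
  assumes j: "j \<in> {1..n}"
  shows "Measurable.pred M (\<lambda>\<omega>. parks n \<alpha> \<xi> j \<omega> = 1)"
proof -
  let ?spot = "\<lambda>S \<omega>. parking_spot n S (\<lambda>t. walk \<alpha> \<xi> j t \<omega>)"
  have "Measurable.pred M (\<lambda>\<omega>. ?spot S \<omega> \<noteq> None)" for S
    by (rule measurable_compose[OF measurable_parking_spot[OF j], where g = "\<lambda>x. x \<noteq> None"]) simp
  moreover have "(\<lambda>\<omega>. occupied n \<alpha> \<xi> \<omega> (j - 1)) \<in> measurable M (count_space (Pow {1..int n}))"
    by (rule measurable_occupied) (use j in auto)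
  ultimately have "Measurable.pred M (\<lambda>\<omega>. ?spot (occupied n \<alpha> \<xi> \<omega> (j - 1)) \<omega> \<noteq> None)"
    by (rule measurable_compose_countable') (simp add: countable_finite)
  then show ?thesis by (simp add: parks_def)
qed

section \<open>Conditioning on the earlier cars\<close>

text \<open>Walk by walk, the condition which the events of the parking protocol reduce to: car \<open>j\<close> reaches
  spot \<open>j\<close> before \<open>0\<close>, at time \<open>t\<close>.\<close>

definition reach_top :: "(nat \<Rightarrow> nat) \<Rightarrow> nat \<Rightarrow> nat \<Rightarrow> 'w \<Rightarrow> bool" where
  "reach_top \<alpha> j t \<omega> \<longleftrightarrow> exits_top_at j (trajectory (int (\<alpha> j)) (\<lambda>s. \<xi> j s \<omega>)) t"

definition all_reach_top :: "(nat \<Rightarrow> nat) \<Rightarrow> nat \<Rightarrow> 'w \<Rightarrow> bool" where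
  "all_reach_top \<alpha> k \<omega> \<longleftrightarrow> (\<forall>j\<in>{1..k}. \<exists>t. reach_top \<alpha> j t \<omega>)"

lemma all_reach_top_Suc:
  "all_reach_top \<alpha> (Suc k) \<omega> \<longleftrightarrow> all_reach_top \<alpha> k \<omega> \<and> (\<exists>t. reach_top \<alpha> (Suc k) t \<omega>)"
proof -
  have "{1..Suc k} = insert (Suc k) {1..k}" by auto
  then show ?thesis unfolding all_reach_top_def by (simp only: Set.ball_simps conj_commute)
qed

lemma pred_reach_top:
  assumes "j \<in> {1..n}"
  shows "Measurable.pred M (reach_top \<alpha> j t)"
  unfolding reach_top_def by (rule pred_exits_top_at) (rule measurable_step[OF assms])

lemma pred_all_reach_top:
  assumes "k \<le> n"
  shows "Measurable.pred M (all_reach_top \<alpha> k)"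
  unfolding all_reach_top_def
proof (rule pred_intros_finite(3))
  show "Measurable.pred M (\<lambda>\<omega>. \<exists>t. reach_top \<alpha> j t \<omega>)" if "j \<in> {1..k}" for j
    by (rule pred_intros_countable(2), rule pred_reach_top) (use that assms in auto)
qed simp

lemma pred_all_park:
  assumes "k \<le> n"
  shows "Measurable.pred M (\<lambda>\<omega>. (\<Prod>j = 1..k. parks n \<alpha> \<xi> j \<omega>) = 1)"
  unfolding prod_parks_eq_1
proof (rule pred_intros_finite(3))
  show "Measurable.pred M (\<lambda>\<omega>. parks n \<alpha> \<xi> j \<omega> = 1)" if "j \<in> {1..k}" for j
    by (rule pred_parks) (use that assms in auto)
qed simp

lemma AE_all_park_iff:
  assumes pref: "\<And>j. j \<in> {1..n} \<Longrightarrow> 1 \<le> \<alpha> j \<and> \<alpha> j \<le> j" and k: "k \<le> n"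
  shows "AE \<omega> in M. (\<Prod>j = 1..k. parks n \<alpha> \<xi> j \<omega>) = 1 \<longleftrightarrow> all_reach_top \<alpha> k \<omega>"
proof (rule AE_mp[OF AE_step], rule AE_I2, rule impI)
  fix \<omega> assume pm: "\<forall>j\<in>{1..n}. \<forall>t. \<xi> j t \<omega> = 1 \<or> \<xi> j t \<omega> = - 1"
  have "\<bar>\<xi> j t \<omega>\<bar> = 1" if "j \<in> {1..n}" for j t
  proof -
    have "\<xi> j t \<omega> = 1 \<or> \<xi> j t \<omega> = - 1" using pm that by blast
    then show ?thesis by auto
  qed
  from all_park_iff[where \<alpha> = \<alpha> and \<xi> = \<xi> and \<omega> = \<omega>, OF this pref k, THEN conjunct1]
  show "(\<Prod>j = 1..k. parks n \<alpha> \<xi> j \<omega>) = 1 \<longleftrightarrow> all_reach_top \<alpha> k \<omega>"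
    unfolding prod_parks_eq_1 all_reach_top_def reach_top_def .
qed

text \<open>The first event depends on the steps of cars \<open>1, \<dots>, k\<close> and the second one on those of car
  \<open>k + 1\<close>.\<close>

lemma prob_all_reach_top_and_reach_top:
  assumes k: "Suc k \<le> n"
  shows "\<P>(\<omega> in M. all_reach_top \<alpha> k \<omega> \<and> reach_top \<alpha> (Suc k) t \<omega>) =
    \<P>(\<omega> in M. all_reach_top \<alpha> k \<omega>) * exit_prob p (Suc k) t (\<alpha> (Suc k))"
proof -
  let ?A = "{1..k} \<times> (UNIV :: nat set)" and ?B = "{Suc k} \<times> (UNIV :: nat set)"
  let ?N = "\<lambda>A. PiM A (\<lambda>_. count_space UNIV) :: (nat \<times> nat \<Rightarrow> int) measure"
  let ?top = "\<lambda>j t f. exits_top_at j (trajectory (int (\<alpha> j)) (\<lambda>s. f (j, s))) t"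
  have top: "Measurable.pred (?N A) (?top j t)" if "{j} \<times> UNIV \<subseteq> A" for j t A
    by (rule pred_exits_top_at, rule measurable_component_singleton) (use that in auto)
  have sub: "?A \<inter> ?B = {}" "?A \<subseteq> {1..n} \<times> UNIV" "?B \<subseteq> {1..n} \<times> UNIV"
    using k by auto
  have "\<P>(\<omega> in M. (\<forall>j\<in>{1..k}. \<exists>t. ?top j t (\<lambda>(j, t). \<xi> j t \<omega>)) \<and> ?top (Suc k) t (\<lambda>(j, t). \<xi> j t \<omega>)) =
    \<P>(\<omega> in M. \<forall>j\<in>{1..k}. \<exists>t. ?top j t (\<lambda>(j, t). \<xi> j t \<omega>)) *
    \<P>(\<omega> in M. ?top (Suc k) t (\<lambda>(j, t). \<xi> j t \<omega>))"
  proof (rule prob_conj_disjoint_steps[OF sub])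
    show "Measurable.pred (?N ?A) (\<lambda>f. \<forall>j\<in>{1..k}. \<exists>t. ?top j t f)"
    proof (rule pred_intros_finite(3))
      show "Measurable.pred (?N ?A) (\<lambda>f. \<exists>t. ?top j t f)" if "j \<in> {1..k}" for j
        by (rule pred_intros_countable(2), rule top) (use that in auto)
    qed simp
    show "Measurable.pred (?N ?B) (?top (Suc k) t)" by (rule top) simp
    show "(\<forall>j\<in>{1..k}. \<exists>t. ?top j t (restrict f ?A)) \<longleftrightarrow> (\<forall>j\<in>{1..k}. \<exists>t. ?top j t f)" for f
      by (rule ball_cong) simp_all
    show "?top (Suc k) t (restrict f ?B) \<longleftrightarrow> ?top (Suc k) t f" for f
      by simp
  qed
  moreover have "\<P>(\<omega> in M. ?top (Suc k) t (\<lambda>(j, t). \<xi> j t \<omega>)) = exit_prob p (Suc k) t (\<alpha> (Suc k))"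
    using prob_exits_top_at[of "Suc k" "Suc k" "\<alpha> (Suc k)" 0 t] k by simp
  ultimately show ?thesis
    unfolding all_reach_top_def reach_top_def by (simp only: prod.case)
qed

text \<open>The exits of car \<open>k + 1\<close> at different times are disjoint, so the probabilities add up over \<open>t\<close>.\<close>

lemma prob_all_reach_top_Suc:
  assumes p: "0 \<le> p" "p \<le> 1" and k: "Suc k \<le> n" and \<alpha>: "\<alpha> (Suc k) \<le> Suc k"
  shows "\<P>(\<omega> in M. all_reach_top \<alpha> (Suc k) \<omega>) =
    \<P>(\<omega> in M. all_reach_top \<alpha> k \<omega>) * reach_prob p (Suc k) (\<alpha> (Suc k))"
proof -
  let ?F = "\<lambda>t. {\<omega> \<in> space M. all_reach_top \<alpha> k \<omega> \<and> reach_top \<alpha> (Suc k) t \<omega>}"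
  have F: "?F t \<in> events" for t
    by (rule predE[OF pred_intros_logic(3)[OF pred_all_reach_top pred_reach_top]])
      (use k in auto)
  have disj: "disjoint_family ?F"
  proof (unfold disjoint_family_on_def, intro ballI impI)
    fix s t :: nat assume "s \<noteq> t"
    then have "\<not> (reach_top \<alpha> (Suc k) s \<omega> \<and> reach_top \<alpha> (Suc k) t \<omega>)" for \<omega>
      unfolding reach_top_def using exits_top_at_unique[of "Suc k" _ s t] by blast
    then show "?F s \<inter> ?F t = {}" by blast
  qed
  have union: "(\<Union>t. ?F t) = {\<omega> \<in> space M. all_reach_top \<alpha> (Suc k) \<omega>}"
    unfolding all_reach_top_Suc by blast
  have total: "(\<lambda>t. prob (?F t)) sums prob (\<Union>t. ?F t)"
    by (rule finite_measure_UNION[OF _ disj]) (use F in blast)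
  have "(\<lambda>t. prob (?F t)) sums
      (\<P>(\<omega> in M. all_reach_top \<alpha> k \<omega>) * reach_prob p (Suc k) (\<alpha> (Suc k)))"
    unfolding prob_all_reach_top_and_reach_top[OF k]
    by (intro sums_mult exit_prob_sums p \<alpha>) simp
  from sums_unique2[OF total[unfolded union] this] show ?thesis .
qed

text \<open>This makes the conditioning in the expected search time legitimate for every \<open>p > 0\<close>.\<close>

lemma prob_all_reach_top_pos:
  assumes p: "0 < p" "p \<le> 1" and k: "k \<le> n"
    and pref: "\<And>j. j \<in> {1..n} \<Longrightarrow> 1 \<le> \<alpha> j \<and> \<alpha> j \<le> j"
  shows "0 < \<P>(\<omega> in M. all_reach_top \<alpha> k \<omega>)"
  using k
proof (induction k)
  case 0
  then show ?case by (simp add: all_reach_top_def prob_space)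
next
  case (Suc k)
  have \<alpha>: "0 < \<alpha> (Suc k)" "\<alpha> (Suc k) \<le> Suc k" using pref[of "Suc k"] Suc.prems by auto
  have p0: "0 \<le> p" using p by simp
  have "0 < reach_prob p (Suc k) (\<alpha> (Suc k))" by (rule reach_prob_pos[OF p \<alpha>])
  moreover have "0 < \<P>(\<omega> in M. all_reach_top \<alpha> k \<omega>)" using Suc by simp
  ultimately show ?case
    unfolding prob_all_reach_top_Suc[where \<alpha> = \<alpha>, OF p0 p(2) Suc.prems \<alpha>(2)] by (rule mult_pos_pos[rotated])
qed

lemma cond_prob_parks:
  assumes p: "0 \<le> p" "p \<le> 1" and k: "Suc k \<le> n"
    and pref: "\<And>j. j \<in> {1..n} \<Longrightarrow> 1 \<le> \<alpha> j \<and> \<alpha> j \<le> j"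
    and pos: "\<P>(\<omega> in M. (\<Prod>j = 1..k. parks n \<alpha> \<xi> j \<omega>) = 1) > 0"
  shows "\<P>(\<omega> in M. parks n \<alpha> \<xi> (Suc k) \<omega> = 1 \<bar> (\<Prod>j = 1..k. parks n \<alpha> \<xi> j \<omega>) = 1) =
    reach_prob p (Suc k) (\<alpha> (Suc k))"
proof -
  have \<alpha>: "\<alpha> (Suc k) \<le> Suc k" using pref[of "Suc k"] k by auto
  have prob_all: "\<P>(\<omega> in M. (\<Prod>j = 1..m. parks n \<alpha> \<xi> j \<omega>) = 1) = \<P>(\<omega> in M. all_reach_top \<alpha> m \<omega>)"
    if "m \<le> n" for m
    by (rule prob_eq_AE[OF AE_all_park_iff[where \<alpha> = \<alpha>, OF pref that] predE[OF pred_all_park[OF that]]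
          predE[OF pred_all_reach_top[OF that]]])
  have both: "(parks n \<alpha> \<xi> (Suc k) \<omega> = 1 \<and> (\<Prod>j = 1..k. parks n \<alpha> \<xi> j \<omega>) = 1) \<longleftrightarrow>
      (\<Prod>j = 1..Suc k. parks n \<alpha> \<xi> j \<omega>) = 1" for \<omega>
  proof -
    have "{1..Suc k} = insert (Suc k) {1..k}" by auto
    then show ?thesis unfolding prod_parks_eq_1 by (simp only: Set.ball_simps)
  qed
  show ?thesis
    unfolding cond_prob_def both prob_all[OF k] prob_all[OF Suc_leD[OF k]]
      prob_all_reach_top_Suc[where \<alpha> = \<alpha>, OF p k \<alpha>]
    using pos unfolding prob_all[OF Suc_leD[OF k]] by simp
qed

text \<open>Almost surely on the conditioning event, car \<open>k + 1\<close> ends its search at a finite time \<open>t\<close>, at spot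
  \<open>k + 1\<close>. The expectation is therefore the series of \<open>t\<close> times the probability of exit at \<open>t\<close>,
  normalised; the common factor coming from cars \<open>1, \<dots>, k\<close> cancels, and dividing by
  \<open>reach_prob\<close> turns \<open>restricted_time\<close> into \<open>reach_time\<close>.\<close>

lemma cond_expect_hit_time:
  assumes p: "0 < p" "p \<le> 1" and k: "Suc k \<le> n"
    and pref: "\<And>j. j \<in> {1..n} \<Longrightarrow> 1 \<le> \<alpha> j \<and> \<alpha> j \<le> j"
  shows "cond_expect_time M (hit_time \<alpha> \<xi> (Suc k))
      (\<lambda>\<omega>. (\<Prod>j = 1..Suc k. parks n \<alpha> \<xi> j \<omega>) = 1) = ereal (reach_time p (Suc k) (\<alpha> (Suc k)))"
proof -
  let ?i = "Suc k"
  let ?h = "reach_prob p ?i (\<alpha> ?i)" and ?D = "reach_time p ?i (\<alpha> ?i)"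
  let ?F = "\<lambda>t. {\<omega> \<in> space M. all_reach_top \<alpha> k \<omega> \<and> reach_top \<alpha> ?i t \<omega>}"
  define S where "S = {\<omega> \<in> space M. (\<Prod>j = 1..?i. parks n \<alpha> \<xi> j \<omega>) = 1}"
  define c where "c = \<P>(\<omega> in M. all_reach_top \<alpha> k \<omega>)"
  have p0: "0 \<le> p" using p by simp
  have mem: "?i \<in> {1..n}" using k by simp
  have \<alpha>: "0 < \<alpha> ?i" "\<alpha> ?i \<le> ?i" using pref[OF mem] by auto
  have h: "0 < ?h" by (rule reach_prob_pos[OF p \<alpha>])
  have c: "0 < c" unfolding c_def by (rule prob_all_reach_top_pos[OF p Suc_leD[OF k] pref])
  have F: "?F t \<in> events" for t
    by (rule predE[OF pred_intros_logic(3)[OF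
          pred_all_reach_top[OF Suc_leD[OF k]] pred_reach_top[OF mem]]])
  have S: "S \<in> events" unfolding S_def by (rule predE[OF pred_all_park[OF k]])
  have AE_S: "AE \<omega> in M. \<omega> \<in> S \<longleftrightarrow> all_reach_top \<alpha> ?i \<omega>"
  proof -
    have "AE \<omega> in M. (\<Prod>j = 1..?i. parks n \<alpha> \<xi> j \<omega>) = 1 \<longleftrightarrow> all_reach_top \<alpha> ?i \<omega>"
      by (rule AE_all_park_iff[OF pref k])
    with AE_space show ?thesis unfolding S_def by eventually_elim blast
  qed
  have prob_S: "emeasure M S = ennreal (c * ?h)"
  proof -
    have "prob S = \<P>(\<omega> in M. all_reach_top \<alpha> ?i \<omega>)"
      unfolding S_def
      by (rule prob_eq_AE[OF AE_all_park_iff[where \<alpha> = \<alpha>, OF pref k] predE[OF pred_all_park[OF k]]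
          predE[OF pred_all_reach_top[OF k]]])
    then show ?thesis
      by (simp only: emeasure_eq_measure prob_all_reach_top_Suc[where \<alpha> = \<alpha>, OF p0 p(2) k \<alpha>(2)] c_def)
  qed
  \<comment> \<open>A visibly measurable series that equals the hitting time almost everywhere on
    the conditioning event.\<close>
  define T where "T \<omega> = (\<Sum>t. ennreal (real t) * indicator {\<omega> \<in> space M. reach_top \<alpha> ?i t \<omega>} \<omega>)" for \<omega>
  have T_meas: "T \<in> borel_measurable M"
  proof -
    have "{\<omega> \<in> space M. reach_top \<alpha> ?i t \<omega>} \<in> events" for t
      by (rule predE[OF pred_reach_top[OF mem]])
    then show ?thesis unfolding T_def by measurable
  qed
  have T_eq: "T \<omega> = ennreal (real t)" if "\<omega> \<in> space M" "reach_top \<alpha> ?i t \<omega>" for \<omega> t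
  proof -
    have "ennreal (real s) * indicator {\<omega> \<in> space M. reach_top \<alpha> ?i s \<omega>} \<omega> =
        (if s = t then ennreal (real t) else 0)" for s
      using that exits_top_at_unique unfolding reach_top_def by (auto simp: indicator_def)
    then have "T \<omega> = (\<Sum>s. if s = t then ennreal (real t) else 0)" unfolding T_def by simp
    also have "\<dots> = ennreal (real t)" by (subst suminf_finite[of "{t}"]) auto
    finally show ?thesis .
  qed
  have "(\<integral>\<^sup>+ \<omega>. ennreal_of_enat (hit_time \<alpha> \<xi> ?i \<omega>) \<partial>uniform_measure M S) =
      (\<integral>\<^sup>+ \<omega>. T \<omega> \<partial>uniform_measure M S)"
  proof (rule nn_integral_cong_AE, rule AE_uniform_measureI[OF S], rule AE_mp[OF AE_S],
      rule AE_I2, intro impI)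
    fix \<omega> assume "\<omega> \<in> space M" "\<omega> \<in> S \<longleftrightarrow> all_reach_top \<alpha> ?i \<omega>" "\<omega> \<in> S"
    then obtain t where "reach_top \<alpha> ?i t \<omega>" unfolding all_reach_top_Suc by blast
    then show "ennreal_of_enat (hit_time \<alpha> \<xi> ?i \<omega>) = T \<omega>"
      using T_eq[OF \<open>\<omega> \<in> space M\<close>] hit_time_eq[of ?i \<alpha> \<xi> \<omega> t]
      by (simp add: reach_top_def ennreal_of_nat_eq_real_of_nat)
  qed
  also have "\<dots> = (\<integral>\<^sup>+ \<omega>. T \<omega> * indicator S \<omega> \<partial>M) / emeasure M S"
    by (rule nn_integral_uniform_measure[OF T_meas S])
  also have "(\<integral>\<^sup>+ \<omega>. T \<omega> * indicator S \<omega> \<partial>M) =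
      (\<integral>\<^sup>+ \<omega>. (\<Sum>t. ennreal (real t) * indicator (?F t) \<omega>) \<partial>M)"
  proof (rule nn_integral_cong_AE, rule AE_mp[OF AE_S], rule AE_I2, rule impI)
    fix \<omega> assume \<omega>: "\<omega> \<in> space M" and iff: "\<omega> \<in> S \<longleftrightarrow> all_reach_top \<alpha> ?i \<omega>"
    have "indicator {\<omega> \<in> space M. reach_top \<alpha> ?i t \<omega>} \<omega> * indicator S \<omega> =
        (indicator (?F t) \<omega> :: ennreal)" for t
      using \<omega> iff unfolding all_reach_top_Suc by (auto simp: indicator_def)
    then have "ennreal (real t) * indicator {\<omega> \<in> space M. reach_top \<alpha> ?i t \<omega>} \<omega> * indicator S \<omega> =
        ennreal (real t) * indicator (?F t) \<omega>" for t
      by (simp only: mult.assoc)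
    then show "T \<omega> * indicator S \<omega> = (\<Sum>t. ennreal (real t) * indicator (?F t) \<omega>)"
      unfolding T_def ennreal_suminf_multc[symmetric] by (simp only:)
  qed
  also have "\<dots> = (\<Sum>t. ennreal (real t) * emeasure M (?F t))"
    using F by (subst nn_integral_suminf) (simp_all add: nn_integral_cmult_indicator)
  also have "\<dots> = ennreal (c * (?h * ?D))"
  proof (rule sums_unique[symmetric])
    have "ennreal (real t) * emeasure M (?F t) = ennreal (c * (real t * exit_prob p ?i t (\<alpha> ?i)))" for t
      unfolding emeasure_eq_measure prob_all_reach_top_and_reach_top[OF k] c_def[symmetric]
      by (simp add: ennreal_mult[symmetric] exit_prob_nonneg[OF p0 p(2)] c less_imp_le ac_simps
          del: exit_prob.simps)
    moreover have "(\<lambda>t. ennreal (c * (real t * exit_prob p ?i t (\<alpha> ?i)))) sums ennreal (c * (?h * ?D))"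
    proof -
      have sums: "(\<lambda>t. c * (real t * exit_prob p ?i t (\<alpha> ?i))) sums (c * (?h * ?D))"
        by (rule sums_mult[OF weighted_time_sums[OF p \<alpha>]])
      have nonneg: "0 \<le> c * (real t * exit_prob p ?i t (\<alpha> ?i))" for t
        using c exit_prob_nonneg[OF p0 p(2)] by simp
      have "0 \<le> c * (?h * ?D)" by (rule sums_le[OF nonneg sums_zero sums])
      then show ?thesis using sums nonneg by simp
    qed
    ultimately show "(\<lambda>t. ennreal (real t) * emeasure M (?F t)) sums ennreal (c * (?h * ?D))"
      by (simp only:)
  qed
  finally have int: "(\<integral>\<^sup>+ \<omega>. ennreal_of_enat (hit_time \<alpha> \<xi> ?i \<omega>) \<partial>uniform_measure M S) =
      ennreal (c * (?h * ?D)) / ennreal (c * ?h)"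
    unfolding prob_S .
  \<comment> \<open>Needed because the passage through extended nonnegative reals truncates negative numbers.\<close>
  have D: "0 \<le> ?D"
  proof -
    have "0 \<le> real t * exit_prob p ?i t (\<alpha> ?i)" for t
      using exit_prob_nonneg[OF p0 p(2)] by simp
    from sums_le[OF this sums_zero weighted_time_sums[OF p \<alpha>]]
    show ?thesis using h by (simp add: zero_le_mult_iff)
  qed
  have "ennreal (c * (?h * ?D)) / ennreal (c * ?h) = ennreal ?D"
    using c h D by (subst divide_ennreal) auto
  then show ?thesis
    unfolding cond_expect_time_def S_def[symmetric] int using D by simp
qed

end

theorem theorem1p5:
  fixes M :: "'w measure" and n i :: nat and p q :: real
    and \<alpha> :: "nat \<Rightarrow> nat" and \<xi> :: "nat \<Rightarrow> nat \<Rightarrow> 'w \<Rightarrow> int"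
  assumes p: "0 \<le> p" "p \<le> 1"
    and q: "q = 1 - p"
    and steps: "parking_steps M n p \<xi>"
    and pref: "\<And>j. j \<in> {1..n} \<Longrightarrow> \<alpha> j \<in> {1..n}"
    and pref_le: "\<And>j. j \<in> {1..n} \<Longrightarrow> \<alpha> j \<le> j"
    and i: "1 < i" "i \<le> n"
  shows
    "(\<P>(\<omega> in M. (\<Prod>j = 1..i - 1. parks n \<alpha> \<xi> j \<omega>) = 1) > 0 \<longrightarrow>
       \<P>(\<omega> in M. parks n \<alpha> \<xi> i \<omega> = 1 \<bar> (\<Prod>j = 1..i - 1. parks n \<alpha> \<xi> j \<omega>) = 1) =
       (if p = 1 / 2 then real (\<alpha> i) / real i
        else p ^ (i - \<alpha> i) * ((p ^ \<alpha> i - q ^ \<alpha> i) / (p ^ i - q ^ i))))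
     \<and>
     (p > 0 \<longrightarrow>
       cond_expect_time M (hit_time \<alpha> \<xi> i) (\<lambda>\<omega>. (\<Prod>j = 1..i. parks n \<alpha> \<xi> j \<omega>) = 1) =
       ereal (if p = 1 / 2 then 1 / 3 * ((real i)\<^sup>2 - (real (\<alpha> i))\<^sup>2)
        else 1 / (p - q) *
          (real i * (1 + (q / p) ^ i) / (1 - (q / p) ^ i)
           - real (\<alpha> i) * (1 + (q / p) ^ \<alpha> i) / (1 - (q / p) ^ \<alpha> i))))"
proof -
  interpret parking_steps M n p \<xi> by (rule steps)
  obtain k where k: "i = Suc k" using i(1) by (cases i) auto
  have le: "Suc k \<le> n" using i(2) k by simp
  have pref': "1 \<le> \<alpha> j \<and> \<alpha> j \<le> j" if "j \<in> {1..n}" for j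
    using pref[OF that] pref_le[OF that] by simp
  have prob: "\<P>(\<omega> in M. (\<Prod>j = 1..k. parks n \<alpha> \<xi> j \<omega>) = 1) > 0 \<longrightarrow>
      \<P>(\<omega> in M. parks n \<alpha> \<xi> (Suc k) \<omega> = 1 \<bar> (\<Prod>j = 1..k. parks n \<alpha> \<xi> j \<omega>) = 1) =
      reach_prob p (Suc k) (\<alpha> (Suc k))"
    by (intro impI cond_prob_parks p le pref')
  have time: "p > 0 \<longrightarrow> cond_expect_time M (hit_time \<alpha> \<xi> (Suc k))
      (\<lambda>\<omega>. (\<Prod>j = 1..Suc k. parks n \<alpha> \<xi> j \<omega>) = 1) = ereal (reach_time p (Suc k) (\<alpha> (Suc k)))"
    by (intro impI cond_expect_hit_time p le pref')
  show ?thesis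
    unfolding k q diff_Suc_1
    using conjI[OF prob time] unfolding reach_prob_def reach_time_def .
qed

end
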